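(* Let $(d_{n,k})_{n,k\ge0}=\left(\frac1{1-t},\frac t{1-t}\right)$ be Pascal's triangle, so $d_{n,k}=\binom nk$. Fix integers $p\ge2$ and $r\ge0$, and let $(\tilde d_{n,k})_{n,k\ge0}$ with $\tilde d_{n,k}=d_{pn+r,(p-1)n+r+k}$, which is a Riordan array $(\tilde g,\tilde f)$ (i.e. $\tilde d_{n,k}=[t^n]\tilde g(t)\tilde f(t)^k$). Then $$\tilde g(t)=\sum_{n\ge0}\binom{pn+r}{n}t^n=\left.\frac{(1+w)^{r+1}}{1-(p-1)w}\right|_{w=w(t)},$$ where $w(t)$ is the formal power series with $w(0)=0$ satisfying $w=t(1+w)^p$, and $$\tilde f(t)=\sum_{n\ge1}\frac{1}{pn+1}\binom{pn+1}{n}t^n=F_p(t)-1=t\,F_p(t)^p,$$ where $F_p(t)=\sum_{k\ge0}\frac{1}{(p-1)k+1}\binom{pk}{k}t^k$ is the $p$th order Fuss–Catalan generating function. Moreover $F_p\big(t(1-t)^{p-1}\big)=\frac1{1-t}$.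
   Context: A Riordan array $(g,f)$ (with $g(0)=1$, $f(0)=0$, $f'(0)\ne0$) is the lower triangular matrix with $(n,k)$ entry $[t^n]g(t)f(t)^k$. The $p$th order Fuss–Catalan function $F_p$ satisfies $F_p(t)=1+tF_p(t)^p$. *)

theory Defs
  imports "HOL-Computational_Algebra.Formal_Power_Series"
begin

text \<open>Side conditions on the pair \<open>(g, f)\<close> of a (proper) Riordan array; the last one is
  \<open>f'(0) \<noteq> 0\<close>.\<close>

definition riordan_pair :: "'a::field_char_0 fps \<Rightarrow> 'a fps \<Rightarrow> bool" where
  "riordan_pair g f \<longleftrightarrow> fps_nth g 0 = 1 \<and> fps_nth f 0 = 0 \<and> fps_nth f 1 \<noteq> 0"

definition riordan_array :: "'a::field_char_0 fps \<Rightarrow> 'a fps \<Rightarrow> nat \<Rightarrow> nat \<Rightarrow> 'a" where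
  "riordan_array g f n k = fps_nth (g * f ^ k) n"

text \<open>Defined by its coefficients; for \<open>p \<ge> 1\<close> this is the unique power series with
  \<open>F = 1 + t F\<^sup>p\<close>. The truncated subtraction is harmless there.\<close>

definition fuss_catalan :: "nat \<Rightarrow> 'a::field_char_0 fps" where
  "fuss_catalan p = Abs_fps (\<lambda>k. 1 / of_nat ((p - 1) * k + 1) * of_nat ((p * k) choose k))"

end

theory Submission
  imports Defs
begin

text \<open>
  Write \<open>L H = \<Sum>\<^sub>n [u\<^sup>n](H(u) \<phi>(u)\<^sup>n) t\<^sup>n\<close>. Since \<open>L (u H) = t L (\<phi> H)\<close>, a solution of
  \<open>w = t \<phi>(w)\<close> satisfies \<open>L H = H(w) L 1\<close>. For \<open>H = 1 - u \<phi>'/\<phi>\<close> only the constant coefficient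
  survives, so \<open>L H = 1\<close> and therefore \<open>L 1 = 1 / (1 - u \<phi>'/\<phi>)(w)\<close>: this is Lagrange inversion.
  With \<open>\<phi> = (1 + u)\<^sup>p\<close> and \<open>H = u\<^sup>k (1 + u)\<^sup>r\<close> the coefficients of \<open>L H\<close> are
  \<open>binom (p n + r) (n - k)\<close>, the entries of the new array, so its second series is \<open>w\<close>;
  \<open>H = 1 - (p - 1) u\<close> gives \<open>1 + w\<close> as the Fuss--Catalan series.
\<close>

section \<open>Diagonal coefficient extraction and Lagrange inversion\<close>

definition fps_diagonal :: "'a::comm_ring_1 fps \<Rightarrow> 'a fps \<Rightarrow> 'a fps" where
  "fps_diagonal \<phi> H = Abs_fps (\<lambda>n. fps_nth (H * \<phi> ^ n) n)"

lemma fps_diagonal_nth: "fps_nth (fps_diagonal \<phi> H) n = fps_nth (H * \<phi> ^ n) n"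
  by (simp add: fps_diagonal_def)

lemma fps_diagonal_add: "fps_diagonal \<phi> (G + H) = fps_diagonal \<phi> G + fps_diagonal \<phi> H"
  by (simp add: fps_eq_iff fps_diagonal_nth algebra_simps)

lemma fps_diagonal_const_mult: "fps_diagonal \<phi> (fps_const c * H) = fps_const c * fps_diagonal \<phi> H"
  by (simp add: fps_eq_iff fps_diagonal_nth mult.assoc)

text \<open>The factor \<open>fps_X\<close> lowers the extracted index by one but not the exponent
  of \<phi>, so one surplus \<phi> moves into the argument.\<close>

lemma fps_diagonal_X_mult: "fps_diagonal \<phi> (fps_X * H) = fps_X * fps_diagonal \<phi> (\<phi> * H)"
proof (rule fps_ext)
  fix n
  show "fps_nth (fps_diagonal \<phi> (fps_X * H)) n = fps_nth (fps_X * fps_diagonal \<phi> (\<phi> * H)) n"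
    by (cases n) (simp_all add: fps_diagonal_nth mult_ac)
qed

lemma fps_diagonal_eq_compose_mult:
  fixes w \<phi> H :: "'a::field fps"
  assumes w: "w = fps_X * (\<phi> oo w)"
  shows "fps_diagonal \<phi> H = (H oo w) * fps_diagonal \<phi> 1"
proof -
  have w0: "fps_nth w 0 = 0"
    by (subst w) simp
  define D where "D = (\<lambda>H. fps_diagonal \<phi> H - (H oo w) * fps_diagonal \<phi> 1)"
  \<comment> \<open>Split off the constant coefficient of \<open>H\<close>. Its contribution cancels
    in \<open>D\<close>, and the remainder leaves a factor \<open>fps_X\<close> in front of another
    value of \<open>D\<close>.\<close>
  have step: "D H = fps_X * D (\<phi> * fps_shift 1 H)" for H
  proof -
    define c G where "c = fps_const (fps_nth H 0)" and "G = fps_shift 1 H"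
    have H: "H = c * 1 + fps_X * G"
      by (rule fps_ext) (auto simp: c_def G_def)
    have L: "fps_diagonal \<phi> H = c * fps_diagonal \<phi> 1 + fps_X * fps_diagonal \<phi> (\<phi> * G)"
      unfolding H by (simp only: fps_diagonal_add fps_diagonal_const_mult fps_diagonal_X_mult c_def)
    have "H oo w = c + w * (G oo w)"
      unfolding H by (simp add: fps_compose_add_distrib fps_compose_mult_distrib w0 c_def)
    also have "w * (G oo w) = fps_X * ((\<phi> * G) oo w)"
      by (subst w) (simp add: fps_compose_mult_distrib w0 mult.assoc)
    finally show ?thesis
      unfolding D_def L G_def [symmetric] by (simp add: algebra_simps)
  qed
  \<comment> \<open>Iterating \<open>step\<close> shows that every power of \<open>fps_X\<close>
    divides \<open>D H\<close>; the argument changes each time, so \<open>H\<close> is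
    generalized.\<close>
  have "fps_nth (D H) n = 0" for n
    by (induction n arbitrary: H; subst step) simp_all
  then have "D H = 0"
    by (simp add: fps_eq_iff)
  then show ?thesis
    by (simp add: D_def)
qed

text \<open>From (\<phi>^n)' = n \<phi>^(n-1) \<phi>', the coefficient of \<phi>' \<phi>^(n-1) at
  n-1 equals that of \<phi>^n at n, once the factor n is cancelled in characteristic 0. Hence only
  the coefficient at 0 remains.\<close>

lemma fps_diagonal_log_deriv:
  fixes \<phi> :: "'a::field_char_0 fps"
  assumes "fps_nth \<phi> 0 \<noteq> 0"
  shows "fps_diagonal \<phi> (1 - fps_X * fps_deriv \<phi> * inverse \<phi>) = 1"
proof (rule fps_ext)
  fix n
  show "fps_nth (fps_diagonal \<phi> (1 - fps_X * fps_deriv \<phi> * inverse \<phi>)) n = fps_nth 1 n"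
  proof (cases n)
    case (Suc m)
    have "inverse \<phi> * \<phi> ^ Suc m = \<phi> ^ m"
      using inverse_mult_eq_1 [OF assms] by (simp add: mult.assoc [symmetric])
    then have "(1 - fps_X * fps_deriv \<phi> * inverse \<phi>) * \<phi> ^ Suc m
        = \<phi> ^ Suc m - fps_X * (fps_deriv \<phi> * \<phi> ^ m)"
      by (simp only: left_diff_distrib mult_1_left mult.assoc)
    then have "fps_nth ((1 - fps_X * fps_deriv \<phi> * inverse \<phi>) * \<phi> ^ Suc m) (Suc m)
        = fps_nth (\<phi> ^ Suc m) (Suc m) - fps_nth (fps_deriv \<phi> * \<phi> ^ m) m"
      by simp
    moreover have "of_nat (Suc m) * fps_nth (\<phi> ^ Suc m) (Suc m)
        = of_nat (Suc m) * fps_nth (fps_deriv \<phi> * \<phi> ^ m) m"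
      using fps_deriv_nth [of "\<phi> ^ Suc m" m]
      by (simp only: fps_deriv_power mult.assoc fps_mult_left_const_nth diff_Suc_1 Suc_eq_plus1 add_diff_cancel_right')
    then have "fps_nth (\<phi> ^ Suc m) (Suc m) = fps_nth (fps_deriv \<phi> * \<phi> ^ m) m"
      by (simp only: mult_cancel_left of_nat_eq_0_iff) simp
    ultimately show ?thesis
      by (simp add: fps_diagonal_nth Suc del: power_Suc)
  qed (simp add: fps_diagonal_nth)
qed

theorem lagrange_inversion:
  fixes w \<phi> H :: "'a::field_char_0 fps"
  assumes w: "w = fps_X * (\<phi> oo w)" and "fps_nth \<phi> 0 \<noteq> 0"
  shows "fps_diagonal \<phi> H * ((1 - fps_X * fps_deriv \<phi> * inverse \<phi>) oo w) = H oo w"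
  using fps_diagonal_log_deriv [OF assms(2)]
  unfolding fps_diagonal_eq_compose_mult [OF w, of H]
    fps_diagonal_eq_compose_mult [OF w, of "1 - fps_X * fps_deriv \<phi> * inverse \<phi>"]
  by (simp only: mult.assoc mult.commute [of "fps_diagonal \<phi> 1"] mult_1_right)

section \<open>Existence and uniqueness of the fixed point\<close>

lemma fps_fixpoint_exists:
  fixes \<phi> :: "'a::field fps"
  assumes "fps_nth \<phi> 0 \<noteq> 0"
  shows "\<exists>w. fps_nth w 0 = 0 \<and> w = fps_X * (\<phi> oo w)"
proof -
  \<comment> \<open>The equation w = t \<phi>(w) says that w is the compositional inverse of u /
    \<phi>(u).\<close>
  define a w where "a = fps_X * inverse \<phi>" and "w = fps_inv a"
  have w0: "fps_nth w 0 = 0"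
    by (simp add: w_def fps_inv_def)
  have "a oo w = fps_X"
    unfolding w_def by (rule fps_inv_right) (simp_all add: a_def assms)
  then have "w * inverse (\<phi> oo w) = fps_X"
    by (simp add: a_def fps_compose_mult_distrib fps_inverse_compose w0 assms)
  then have "fps_X * (\<phi> oo w) = w * (inverse (\<phi> oo w) * (\<phi> oo w))"
    by (metis mult.assoc)
  also have "\<dots> = w"
    by (simp add: inverse_mult_eq_1 assms)
  finally show ?thesis
    using w0 by metis
qed

text \<open>The difference of two solutions is annihilated by \<open>1 - v * Q\<close>, whose
  constant coefficient is 1. A general \<open>v\<close> is allowed because the closing identity on
  F_p needs v = t (1-t)^(p-1).\<close>

lemma fps_power_fixpoint_unique:
  fixes v y z :: "'a::field fps"
  assumes v: "fps_nth v 0 = 0" and y: "y = v * (1 + y) ^ p" and z: "z = v * (1 + z) ^ p"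
  shows "y = z"
proof -
  define Q where "Q = (\<Sum>i<p. (1 + z) ^ (p - Suc i) * (1 + y) ^ i)"
  have "y - z = v * ((1 + y) ^ p - (1 + z) ^ p)"
    using y z by (metis right_diff_distrib)
  also have "\<dots> = v * ((y - z) * Q)"
    unfolding Q_def by (subst power_diff_sumr2) simp
  finally have "(y - z) * (1 - v * Q) = 0"
    by (simp add: algebra_simps)
  moreover have "fps_nth (1 - v * Q) 0 \<noteq> 0"
    by (simp add: v)
  then have "1 - v * Q \<noteq> 0"
    by (metis fps_zero_nth)
  ultimately show ?thesis
    by simp
qed

section \<open>Binomial series and Pascal's triangle\<close>

lemma one_plus_fps_X_power_nth:
  "fps_nth ((1 + fps_X :: 'a::field_char_0 fps) ^ m) n = of_nat (m choose n)"
  by (simp flip: fps_binomial_of_nat add: binomial_gbinomial)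

lemma one_plus_fps_X_power_compose:
  fixes w :: "'a::field fps"
  assumes "fps_nth w 0 = 0"
  shows "(1 + fps_X) ^ p oo w = (1 + w) ^ p"
  by (simp add: assms fps_compose_add_distrib flip: fps_compose_power)

text \<open>The case split matters: for n < k the truncated \<open>n - k\<close> is 0 and the
  binomial would be 1 instead of 0.\<close>

lemma fps_diagonal_binomial:
  "fps_nth (fps_diagonal ((1 + fps_X) ^ p) (fps_X ^ k * (1 + fps_X) ^ r)) n
     = (if n < k then 0 else of_nat ((p * n + r) choose (n - k)) :: 'a::field_char_0)"
  by (simp add: fps_diagonal_nth mult.assoc fps_X_power_mult_nth one_plus_fps_X_power_nth
      add.commute [of r] flip: power_mult power_add)

lemma pascal_riordan_array:
  "riordan_array (1 / (1 - fps_X)) (fps_X / (1 - fps_X)) n k = (of_nat (n choose k) :: 'a::field_char_0)"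
proof -
  define I where "I = (inverse (1 - fps_X) :: 'a fps)"
  have I: "I * (1 - fps_X) = 1"
    unfolding I_def by (rule inverse_mult_eq_1) simp
  define h where "h = (\<lambda>k. I * (fps_X * I) ^ k)"
  \<comment> \<open>Multiplying column k by 1 - t cancels one factor \<open>I\<close>; read
    coefficientwise, this is Pascal's recurrence.\<close>
  have h: "h k - fps_X * h k = (if k = 0 then 1 else fps_X * h (k - 1))" for k
  proof -
    have "h k - fps_X * h k = (I * (1 - fps_X)) * (fps_X * I) ^ k"
      by (simp add: h_def algebra_simps)
    then show ?thesis
      by (cases k) (simp_all add: I h_def mult_ac)
  qed
  have h_Suc: "fps_nth (h k) (Suc n) = fps_nth (h k) n + (if k = 0 then 0 else fps_nth (h (k - 1)) n)" for n k
    using arg_cong [OF h, of "\<lambda>f. fps_nth f (Suc n)" k] by (auto simp: algebra_simps split: if_splits)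
  have h_0: "fps_nth (h k) 0 = (if k = 0 then 1 else 0)" for k
    using arg_cong [OF h, of "\<lambda>f. fps_nth f 0" k] by (auto split: if_splits)
  have "fps_nth (h k) n = of_nat (n choose k)"
  proof (induction n arbitrary: k)
    case 0
    then show ?case by (simp add: h_0)
  next
    case (Suc n)
    then show ?case by (cases k) (simp_all add: h_Suc)
  qed
  then show ?thesis
    by (simp add: riordan_array_def h_def I_def fps_divide_unit)
qed

section \<open>Fuss--Catalan numbers and the fixed point\<close>

lemma fuss_catalan_conv_binomial:
  assumes "p \<ge> 1"
  shows "1 / of_nat ((p - 1) * n + 1) * of_nat ((p * n) choose n)
    = (1 / of_nat (p * n + 1) * of_nat ((p * n + 1) choose n) :: 'a::field_char_0)"
proof -
  have "p * n + 1 - n = (p - 1) * n + 1"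
    using assms by (cases p) auto
  \<comment> \<open>Absorption: (N - n) binom(N, n) = N binom(N - 1, n) with N = pn + 1.\<close>
  then have "((p - 1) * n + 1) * ((p * n + 1) choose n) = (p * n + 1) * ((p * n) choose n)"
    using binomial_absorb_comp [of "p * n + 1" n] by simp
  then have "of_nat ((p - 1) * n + 1) * of_nat ((p * n + 1) choose n)
      = (of_nat (p * n + 1) * of_nat ((p * n) choose n) :: 'a)"
    by (metis of_nat_mult)
  moreover have "(of_nat ((p - 1) * n + 1) :: 'a) \<noteq> 0" "(of_nat (p * n + 1) :: 'a) \<noteq> 0"
    by (simp_all only: of_nat_eq_0_iff)
  ultimately show ?thesis
    by (simp add: divide_simps mult.commute del: of_nat_add of_nat_mult of_nat_Suc)
qed

lemma fuss_catalan_eq_diagonal: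
  assumes "p \<ge> 1"
  shows "(fuss_catalan p :: 'a::field_char_0 fps)
    = fps_diagonal ((1 + fps_X) ^ p) (1 - of_nat (p - 1) * fps_X)"
proof (rule fps_ext)
  fix n
  show "fps_nth (fuss_catalan p) n
    = fps_nth (fps_diagonal ((1 + fps_X) ^ p) (1 - of_nat (p - 1) * fps_X) :: 'a fps) n"
  proof (cases n)
    case 0
    then show ?thesis
      by (simp add: fuss_catalan_def fps_diagonal_nth)
  next
    case (Suc m)
    have "(1 - of_nat (p - 1) * fps_X) * ((1 + fps_X) ^ p) ^ n
        = (1 + fps_X) ^ (p * n) - fps_const (of_nat (p - 1)) * (fps_X * (1 + fps_X :: 'a fps) ^ (p * n))"
      by (simp add: algebra_simps fps_of_nat flip: power_mult)
    then have rhs: "fps_nth (fps_diagonal ((1 + fps_X) ^ p) (1 - of_nat (p - 1) * fps_X) :: 'a fps) n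
        = of_nat ((p * n) choose n) - of_nat (p - 1) * of_nat ((p * n) choose m)"
      by (simp add: fps_diagonal_nth one_plus_fps_X_power_nth Suc del: of_nat_Suc)
    have "p * n - m = (p - 1) * n + 1"
      using assms Suc by (cases p) auto
    then have "n * ((p * n) choose n) = ((p - 1) * n + 1) * ((p * n) choose m)"
      using binomial_absorb_comp [of "p * n" m] binomial_absorption [of m "p * n"] Suc by simp
    then have absorb: "of_nat n * of_nat ((p * n) choose n)
        = (of_nat ((p - 1) * n + 1) * of_nat ((p * n) choose m) :: 'a)"
      by (metis of_nat_mult)
    have split: "of_nat ((p - 1) * n + 1) = of_nat (p - 1) * of_nat n + (1 :: 'a)"
      by (simp only: of_nat_add of_nat_mult of_nat_1)
    have nz: "(of_nat ((p - 1) * n + 1) :: 'a) \<noteq> 0"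
      by (simp only: of_nat_eq_0_iff)
    \<comment> \<open>By absorption the second binomial becomes n binom(pn, n), so the factor (p-1)n
      + 1 is reduced by (p-1)n and only 1 is left.\<close>
    have "of_nat ((p - 1) * n + 1) * (of_nat ((p * n) choose n) - of_nat (p - 1) * of_nat ((p * n) choose m))
        = of_nat ((p - 1) * n + 1) * of_nat ((p * n) choose n)
          - of_nat (p - 1) * (of_nat n * of_nat ((p * n) choose n) :: 'a)"
      unfolding absorb by (simp only: right_diff_distrib mult.left_commute)
    also have "\<dots> = of_nat ((p * n) choose n)"
      unfolding split by (simp only: distrib_right mult.assoc mult_1_left add_diff_cancel_left')
    finally show ?thesis
      unfolding rhs using nz
      by (simp add: fuss_catalan_def divide_simps mult.commute del: of_nat_add of_nat_mult of_nat_Suc)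
  qed
qed

text \<open>For \<phi> = (1+u)^p one has 1 - u \<phi>'/\<phi> = (1 - (p-1)u) / (1+u); multiplying by
  1 + u keeps the statement free of division.\<close>

lemma lagrange_inversion_binomial:
  fixes w H :: "'a::field_char_0 fps"
  assumes p: "p \<ge> 1" and w0: "fps_nth w 0 = 0" and w: "w = fps_X * (1 + w) ^ p"
  shows "fps_diagonal ((1 + fps_X) ^ p) H * ((1 - of_nat (p - 1) * fps_X) oo w) = (H * (1 + fps_X)) oo w"
proof -
  let ?\<phi> = "(1 + fps_X :: 'a fps) ^ p"
  have fixpoint: "w = fps_X * (?\<phi> oo w)"
    using w by (simp add: one_plus_fps_X_power_compose w0)
  have nz: "fps_nth ?\<phi> 0 \<noteq> 0"
    by simp
  have deriv: "fps_deriv ?\<phi> = of_nat p * (1 + fps_X) ^ (p - 1)"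
    by (simp add: fps_deriv_power')
  have power: "?\<phi> = (1 + fps_X) ^ (p - 1) * (1 + fps_X)"
    using p by (cases p) auto
  have "fps_X * fps_deriv ?\<phi> * inverse ?\<phi> * (1 + fps_X) = of_nat p * fps_X * (((1 + fps_X) ^ (p - 1) * (1 + fps_X)) * inverse ?\<phi>)"
    unfolding deriv by (simp only: mult_ac)
  also have "(1 + fps_X) ^ (p - 1) * (1 + fps_X) = ?\<phi>"
    by (rule power [symmetric])
  also have "?\<phi> * inverse ?\<phi> = 1"
    using inverse_mult_eq_1 [OF nz] by (simp only: mult.commute)
  finally have N: "1 - of_nat (p - 1) * fps_X = (1 - fps_X * fps_deriv ?\<phi> * inverse ?\<phi>) * (1 + fps_X)"
    using p by (simp add: of_nat_diff algebra_simps)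
  show ?thesis
    unfolding N fps_compose_mult_distrib [OF w0, of _ "1 + fps_X"]
    by (simp only: mult.assoc [symmetric] lagrange_inversion [OF fixpoint nz])
qed

lemma one_minus_mult_fps_X_compose_nonzero:
  fixes w :: "'a::field fps"
  shows "(1 - of_nat m * fps_X) oo w \<noteq> 0"
proof -
  have "fps_nth ((1 - of_nat m * fps_X) oo w) 0 \<noteq> 0"
    by simp
  then show ?thesis
    by (metis fps_zero_nth)
qed

text \<open>With H = 1 - (p-1)u the nonzero factor H(w) stands on both sides of the inversion
  formula; cancelling it leaves 1 + w.\<close>

lemma fuss_catalan_eq_one_plus_fixpoint:
  fixes w :: "'a::field_char_0 fps"
  assumes "p \<ge> 1" "fps_nth w 0 = 0" "w = fps_X * (1 + w) ^ p"
  shows "fuss_catalan p = 1 + w"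
  unfolding fuss_catalan_eq_diagonal [OF assms(1)]
  using lagrange_inversion_binomial [OF assms, of "1 - of_nat (p - 1) * fps_X"]
    one_minus_mult_fps_X_compose_nonzero [of "p - 1" w]
  by (simp add: assms(2) fps_compose_mult_distrib fps_compose_add_distrib
      mult.commute)

text \<open>Both w(v) and t/(1-t) solve y = v (1+y)^p for v = t (1-t)^(p-1), so they agree, and F_p
  = 1 + w.\<close>

lemma fuss_catalan_compose:
  assumes "p \<ge> 2"
  shows "fuss_catalan p oo (fps_X * (1 - fps_X) ^ (p - 1)) = 1 / (1 - fps_X :: 'a::field_char_0 fps)"
proof -
  define I v where "I = (inverse (1 - fps_X) :: 'a fps)" and "v = (fps_X * (1 - fps_X) ^ (p - 1) :: 'a fps)"
  have I: "(1 - fps_X) * I = 1"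
    unfolding I_def mult.commute [of "1 - fps_X"] by (rule inverse_mult_eq_1) simp
  have v0: "fps_nth v 0 = 0"
    by (simp add: v_def)
  obtain w :: "'a fps" where w0: "fps_nth w 0 = 0" and w: "w = fps_X * (1 + w) ^ p"
    using fps_fixpoint_exists [of "(1 + fps_X :: 'a fps) ^ p"]
    by (auto simp: one_plus_fps_X_power_compose)
  have "w oo v = v * (1 + (w oo v)) ^ p"
    by (subst w) (simp add: fps_compose_mult_distrib fps_compose_add_distrib v0 flip: fps_compose_power)
  moreover have "fps_X * I = v * (1 + fps_X * I) ^ p"
  proof -
    have "1 + fps_X * I = I"
      using I by (simp add: algebra_simps)
    moreover have "I ^ p = I ^ (p - 1) * I"
      using assms by (cases p) auto
    moreover have "(1 - fps_X) ^ (p - 1) * I ^ (p - 1) = 1"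
      using I by (simp flip: power_mult_distrib)
    ultimately show ?thesis
      unfolding v_def by (metis mult.assoc mult_1_left)
  qed
  ultimately have "w oo v = fps_X * I"
    by (rule fps_power_fixpoint_unique [OF v0])
  moreover have "1 + fps_X * I = I"
    using I by (simp add: algebra_simps)
  ultimately have "(1 + w) oo v = I"
    by (simp add: fps_compose_add_distrib)
  moreover have "fuss_catalan p = 1 + w"
    using assms by (intro fuss_catalan_eq_one_plus_fixpoint w0 w) simp
  ultimately show ?thesis
    by (simp add: v_def I_def fps_divide_unit)
qed

section \<open>Determination of the pair by its array, and the new array\<close>

lemma riordan_array_inject:
  assumes "riordan_pair g f" "riordan_array g f = riordan_array g' f'"
  shows "g' = g" "f' = f"
proof -
  \<comment> \<open>Compare columns: column 0 yields g, and column 1 yields f after cancelling the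
    nonzero g.\<close>
  have eq: "g * f ^ k = g' * f' ^ k" for k
    using assms(2) by (intro fps_ext) (metis riordan_array_def)
  show g: "g' = g"
    using eq [of 0] by simp
  have "g \<noteq> 0"
    using assms(1) by (auto simp: riordan_pair_def)
  then show "f' = f"
    using eq [of 1] g by simp
qed

theorem theorem4p1:
  fixes p r :: nat
    and d dt :: "nat \<Rightarrow> nat \<Rightarrow> 'a::field_char_0"
  assumes p: "p \<ge> 2"
    and d: "d = riordan_array (1 / (1 - fps_X)) (fps_X / (1 - fps_X))"
    and dt: "dt = (\<lambda>n k. d (p * n + r) ((p - 1) * n + r + k))"
  shows "riordan_pair (1 / (1 - fps_X) :: 'a fps) (fps_X / (1 - fps_X))
    \<and> (\<forall>n k. d n k = of_nat (n choose k))
    \<and> (\<exists>gt ft. riordan_pair gt ft \<and> dt = riordan_array gt ft)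
    \<and> (\<exists>!w :: 'a fps. fps_nth w 0 = 0 \<and> w = fps_X * (1 + w) ^ p)
    \<and> (\<forall>gt ft w. riordan_pair gt ft \<and> dt = riordan_array gt ft
          \<and> fps_nth w 0 = 0 \<and> w = fps_X * (1 + w) ^ p \<longrightarrow>
        gt = Abs_fps (\<lambda>n. of_nat ((p * n + r) choose n))
        \<and> gt = fps_compose ((1 + fps_X) ^ (r + 1) / (1 - of_nat (p - 1) * fps_X)) w
        \<and> ft = Abs_fps (\<lambda>n. if n = 0 then 0
                            else 1 / of_nat (p * n + 1) * of_nat ((p * n + 1) choose n))
        \<and> ft = fuss_catalan p - 1
        \<and> ft = fps_X * fuss_catalan p ^ p)
    \<and> fps_compose (fuss_catalan p) (fps_X * (1 - fps_X) ^ (p - 1)) = 1 / (1 - fps_X :: 'a fps)"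
proof -
  define \<phi> where "\<phi> = (1 + fps_X :: 'a fps) ^ p"
  define G where "G = fps_diagonal \<phi> ((1 + fps_X) ^ r)"
  have p1: "p \<ge> 1"
    using p by simp
  obtain w :: "'a fps" where w0: "fps_nth w 0 = 0" and w: "w = fps_X * (1 + w) ^ p"
    using fps_fixpoint_exists [of \<phi>] by (auto simp: \<phi>_def one_plus_fps_X_power_compose)
  have w_unique: "w' = w" if "w' = fps_X * (1 + w') ^ p" for w'
    using fps_power_fixpoint_unique [OF _ that w] by simp
  have "w = fps_X * (\<phi> oo w)"
    using w by (simp add: \<phi>_def one_plus_fps_X_power_compose w0)
  note diag = fps_diagonal_eq_compose_mult [OF this]
  have d': "d n k = of_nat (n choose k)" for n k
    by (simp add: d pascal_riordan_array)
  have G: "G = Abs_fps (\<lambda>n. of_nat ((p * n + r) choose n))"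
    using fps_diagonal_binomial [of p 0 r] by (auto simp: fps_eq_iff G_def \<phi>_def)
  have dt': "dt = riordan_array G w"
  proof (intro ext)
    fix n k
    \<comment> \<open>Both sides equal w^k (1+w)^r times
      \<open>fps_diagonal \<phi> 1\<close>.\<close>
    have "G * w ^ k = fps_diagonal \<phi> (fps_X ^ k * (1 + fps_X) ^ r)"
      unfolding G_def diag [of "(1 + fps_X) ^ r"] diag [of "fps_X ^ k * (1 + fps_X) ^ r"]
      by (simp add: fps_compose_mult_distrib fps_X_power_compose w0 mult_ac)
    then have "riordan_array G w n k = (if n < k then 0 else of_nat ((p * n + r) choose (n - k)))"
      by (simp add: riordan_array_def \<phi>_def fps_diagonal_binomial)
    moreover have pn: "p * n = (p - 1) * n + n"
      using p1 by (cases p) auto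
    \<comment> \<open>Symmetry of binomials, as the lower indices add up to pn + r; for n < k the
      lower index on the left exceeds the upper one.\<close>
    have "(p * n + r) choose ((p - 1) * n + r + k) = (if n < k then 0 else (p * n + r) choose (n - k))"
    proof (cases "n < k")
      case False
      then show ?thesis
        using binomial_symmetric [of "n - k" "p * n + r"] by (simp add: pn add_ac)
    qed (simp add: pn)
    ultimately show "dt n k = riordan_array G w n k"
      by (simp add: dt d')
  qed
  have w1: "fps_nth w 1 = 1"
    by (subst w) (simp add: startsby_power [of _ 1] w0)
  have pair: "riordan_pair G w"
    by (simp add: riordan_pair_def w0 w1 [simplified] G)
  have F: "fuss_catalan p = 1 + w"
    by (rule fuss_catalan_eq_one_plus_fixpoint [OF p1 w0 w])
  have G_compose: "G = ((1 + fps_X) ^ (r + 1) / (1 - of_nat (p - 1) * fps_X)) oo w"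
  proof -
    let ?N = "1 - of_nat (p - 1) * fps_X :: 'a fps"
    \<comment> \<open>Composition passes through the quotient because \<open>?N\<close> has constant
      coefficient 1 and thus divides every series.\<close>
    have "((1 + fps_X) ^ (r + 1) / ?N) oo w = ((1 + fps_X) ^ (r + 1) oo w) / (?N oo w)"
      by (rule fps_compose_divide_distrib)
        (simp_all add: w0 one_minus_mult_fps_X_compose_nonzero fps_dvd_iff)
    also have "(1 + fps_X) ^ (r + 1) oo w = G * (?N oo w)"
      unfolding G_def \<phi>_def lagrange_inversion_binomial [OF p1 w0 w] by (simp add: mult.commute)
    finally show ?thesis
      by (simp add: one_minus_mult_fps_X_compose_nonzero)
  qed
  have w_nth: "w = Abs_fps (\<lambda>n. if n = 0 then 0
      else 1 / of_nat (p * n + 1) * of_nat ((p * n + 1) choose n))"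
  proof (rule fps_ext)
    fix n
    have "fps_nth w n = fps_nth (fuss_catalan p) n" if "n \<noteq> 0"
      using that by (simp add: F)
    then show "fps_nth w n = fps_nth (Abs_fps (\<lambda>n. if n = 0 then 0
        else 1 / of_nat (p * n + 1) * of_nat ((p * n + 1) choose n))) n"
      using fuss_catalan_conv_binomial [OF p1, of n, where 'a = 'a] w0 by (simp add: fuss_catalan_def)
  qed
  show ?thesis
  proof (intro conjI allI impI)
    show "riordan_pair (1 / (1 - fps_X) :: 'a fps) (fps_X / (1 - fps_X))"
      by (simp add: riordan_pair_def fps_divide_unit)
    show "d n k = of_nat (n choose k)" for n k
      by (rule d')
    show "\<exists>gt ft. riordan_pair gt ft \<and> dt = riordan_array gt ft"
      using pair dt' by blast
    show "\<exists>!w :: 'a fps. fps_nth w 0 = 0 \<and> w = fps_X * (1 + w) ^ p"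
      using w0 w w_unique by blast
    show "fuss_catalan p oo (fps_X * (1 - fps_X) ^ (p - 1)) = 1 / (1 - fps_X :: 'a fps)"
      by (rule fuss_catalan_compose [OF p])
  next
    fix gt ft w' :: "'a fps"
    assume *: "riordan_pair gt ft \<and> dt = riordan_array gt ft
      \<and> fps_nth w' 0 = 0 \<and> w' = fps_X * (1 + w') ^ p"
    have w': "w' = w"
      using * w_unique by blast
    have gf: "gt = G" "ft = w"
      using riordan_array_inject [OF pair, of gt ft] * dt' by auto
    show "gt = Abs_fps (\<lambda>n. of_nat ((p * n + r) choose n))"
      using gf G by simp
    show "gt = ((1 + fps_X) ^ (r + 1) / (1 - of_nat (p - 1) * fps_X)) oo w'"
      unfolding gf w' by (rule G_compose)
    show "ft = Abs_fps (\<lambda>n. if n = 0 then 0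
        else 1 / of_nat (p * n + 1) * of_nat ((p * n + 1) choose n))"
      unfolding gf by (rule w_nth)
    show "ft = fuss_catalan p - 1"
      by (simp add: gf F)
    show "ft = fps_X * fuss_catalan p ^ p"
      unfolding gf F by (rule w)
  qed
qed

end
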